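(* Let $k \in \mathbb{N}$ (positive integers) and let $Y$ be a Young diagram. Then $Y$ can be covered by a set $C$ of generalized rectangles such that each row and each column of $Y$ is used by at most $k$ rectangles in $C$ if and only if $Y$ has strictly less than $\binom{2k}{k}$ steps.
   Context: For $x \in \mathbb{N}$ let $[x] = \{1,\ldots,x\}$. A Young diagram with $r$ rows and $c$ columns is a subset $Y \subseteq [r] \times [c]$ such that whenever $(i,j) \in Y$, then $(i-1,j) \in Y$ if $i \geq 2$ and $(i,j-1) \in Y$ if $j \geq 2$. The steps of $Y$ are the elements of $Z = \{(s,t) \in Y : (s+1,t) \notin Y \text{ and } (s,t+1) \notin Y\}$; the number of steps is $|Z|$ (equivalently, the number of distinct row lengths). A generalized rectangle in $Y$ is a set $R = S \times T$ with $S \subseteq [r]$, $T \subseteq [c]$ and $R \subseteq Y$; it uses the rows in $S$ and the columns in $T$. A set $C$ of generalized rectangles covers $Y$ if $Y = \bigcup_{R \in C} R$. *)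

theory Defs
  imports Main
begin

(* Cells are pairs (row, column), both indexed from 1. Rows or columns of
   [r] x [c] may contain no cell of Y, and Y may be empty. *)
definition young_diagram :: "nat \<Rightarrow> nat \<Rightarrow> (nat \<times> nat) set \<Rightarrow> bool" where
  "young_diagram r c Y \<longleftrightarrow>
     Y \<subseteq> {1..r} \<times> {1..c} \<and>
     (\<forall>i j. (i, j) \<in> Y \<longrightarrow>
        (i \<ge> 2 \<longrightarrow> (i - 1, j) \<in> Y) \<and> (j \<ge> 2 \<longrightarrow> (i, j - 1) \<in> Y))"

definition steps :: "(nat \<times> nat) set \<Rightarrow> (nat \<times> nat) set" where
  "steps Y = {(s, t). (s, t) \<in> Y \<and> (s + 1, t) \<notin> Y \<and> (s, t + 1) \<notin> Y}"

(* A generalized rectangle S x T is recorded as the pair (S, T), so that the rows and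
   columns it uses are determined even when the product is empty. *)
type_synonym gen_rect = "nat set \<times> nat set"

definition cells :: "gen_rect \<Rightarrow> (nat \<times> nat) set" where
  "cells R = fst R \<times> snd R"

definition gen_rectangle_in :: "nat \<Rightarrow> nat \<Rightarrow> (nat \<times> nat) set \<Rightarrow> gen_rect \<Rightarrow> bool" where
  "gen_rectangle_in r c Y R \<longleftrightarrow> fst R \<subseteq> {1..r} \<and> snd R \<subseteq> {1..c} \<and> cells R \<subseteq> Y"

definition uses_row :: "gen_rect \<Rightarrow> nat \<Rightarrow> bool" where
  "uses_row R i \<longleftrightarrow> i \<in> fst R"

definition uses_column :: "gen_rect \<Rightarrow> nat \<Rightarrow> bool" where
  "uses_column R j \<longleftrightarrow> j \<in> snd R"

definition covers :: "gen_rect set \<Rightarrow> (nat \<times> nat) set \<Rightarrow> bool" where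
  "covers C Y \<longleftrightarrow> Y = (\<Union>R\<in>C. cells R)"

end

theory Submission
  imports Defs "HOL-Computational_Algebra.Polynomial" "HOL-Library.Function_Algebras"
begin

text \<open>
  Sufficiency: choose a step \<open>(s, t)\<close> and use the full rectangle with corner \<open>(s, t)\<close>; the
  cells below it and the cells to its right form two smaller diagrams sharing neither rows nor
  columns. If rows may be used \<open>a\<close> times and columns \<open>b\<close> times, the budgets of these two diagrams
  are \<open>(a, b - 1)\<close> and \<open>(a - 1, b)\<close>, so the bound on the number of steps obeys Pascal's recursion.

  Necessity: for a step in row \<open>s\<close> and column \<open>t\<close> let \<open>A\<close> be the set of rectangles using row
  \<open>s + 1\<close> and \<open>B\<close> the set of those using column \<open>t\<close>; together with the pair of row \<open>1\<close> and
  column \<open>0\<close> these pairs satisfy the hypotheses of the skew version of Bollobas's set pair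
  theorem. The latter is proved by mapping the ground set injectively into the reals: the functional
  taking a polynomial \<open>p\<close> of degree at most \<open>a\<close> to the product of its values at the points of
  \<open>B\<close> is a form of degree \<open>b\<close> in the \<open>a + 1\<close> coefficients of \<open>p\<close>, and evaluating it at the
  polynomial with root set \<open>A\<close> gives a triangular matrix.
\<close>

section \<open>The skew set pair theorem\<close>

interpretation fun_vs: vector_space "\<lambda>(c::real) (f::'u \<Rightarrow> real) x. c * f x"
  by unfold_locales (auto simp: fun_eq_iff algebra_simps)

text \<open>Indices are added from the largest downwards: all functions already present vanish at
  \<open>p i\<close> for the new smallest \<open>i\<close>, hence so does their span, while
  \<open>F i\<close> does not. Injectivity of \<open>F\<close> on \<open>I\<close> is carried along
  as a cardinality.\<close>

lemma triangular_card_le: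
  fixes F :: "'i::linorder \<Rightarrow> 'u \<Rightarrow> real"
  assumes "finite I" "finite T"
    and "\<And>i. i \<in> I \<Longrightarrow> F i \<in> fun_vs.span T"
    and "\<And>i. i \<in> I \<Longrightarrow> F i (p i) \<noteq> 0"
    and "\<And>i j. i \<in> I \<Longrightarrow> j \<in> I \<Longrightarrow> i < j \<Longrightarrow> F j (p i) = 0"
  shows "card I \<le> card T"
proof -
  have "fun_vs.independent (F ` I) \<and> card (F ` I) = card I"
    using assms(1,4,5)
  proof (induction I rule: finite_linorder_min_induct)
    case empty
    then show ?case by (simp add: fun_vs.independent_empty)
  next
    case (insert i I)
    have "g (p i) = 0" if "g \<in> fun_vs.span (F ` I)" for g
      using that
    proof (induction rule: fun_vs.span_induct_alt)
      case base
      then show ?case by simp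
    next
      case (step c x y)
      then show ?case using insert by auto
    qed
    then have notin: "F i \<notin> fun_vs.span (F ` I)"
      using insert.prems(1)[of i] by auto
    then have "F i \<notin> F ` I"
      using fun_vs.span_base by blast
    moreover have "fun_vs.independent (F ` I) \<and> card (F ` I) = card I"
      using insert.IH insert.prems by blast
    moreover have "i \<notin> I" using insert.hyps by auto
    ultimately show ?case
      using notin insert.hyps(1) by (simp add: fun_vs.independent_insertI)
  qed
  moreover have "F ` I \<subseteq> fun_vs.span T" using assms(3) by auto
  ultimately show ?thesis
    using fun_vs.independent_span_bound[OF assms(2)] by metis
qed

section \<open>Monomials of degree \<open>b\<close> in the coefficients \<open>u 0\<close>, ...,
  \<open>u a\<close>\<close>

definition monomials :: "nat \<Rightarrow> nat \<Rightarrow> ((nat \<Rightarrow> real) \<Rightarrow> real) set" where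
  "monomials a b =
     (\<lambda>l u. \<Prod>j\<le>a. u j ^ (l ! j)) ` {l. length l = Suc a \<and> sum_list l = b}"

lemma finite_lists_sum: "finite {l::nat list. length l = n \<and> sum_list l = b}"
proof (rule finite_subset)
  show "{l. length l = n \<and> sum_list l = b} \<subseteq> {l. set l \<subseteq> {..b} \<and> length l = n}"
    using member_le_sum_list by auto
  show "finite {l. set l \<subseteq> {..b} \<and> length l = n}"
    by (simp add: finite_lists_length_eq)
qed

lemma finite_monomials: "finite (monomials a b)"
  unfolding monomials_def using finite_lists_sum by (rule finite_imageI)

text \<open>Stars and bars for the exponent lists.\<close>

lemma card_monomials_le: "card (monomials a b) \<le> (a + b) choose a"
proof -
  have "card (monomials a b) \<le> card {l::nat list. length l = Suc a \<and> sum_list l = b}"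
    unfolding monomials_def using finite_lists_sum by (rule card_image_le)
  also have "\<dots> = (b + a) choose b"
    by (subst card_length_sum_list) simp
  also have "\<dots> = (a + b) choose a"
    by (metis add.commute add_diff_cancel_left' binomial_symmetric le_add1)
  finally show ?thesis .
qed

lemma coordinate_times_monomial:
  assumes "m \<in> monomials a b" "j \<le> a"
  shows "(\<lambda>u. u j * m u) \<in> monomials a (Suc b)"
proof -
  obtain l where l: "length l = Suc a" "sum_list l = b" "m = (\<lambda>u. \<Prod>j\<le>a. u j ^ (l ! j))"
    using assms(1) by (auto simp: monomials_def)
  let ?l = "l[j := Suc (l ! j)]"
  have "l ! j \<le> sum_list l"
    using l assms(2) by (intro elem_le_sum_list) auto
  then have "sum_list ?l = Suc b"
    using l assms(2) by (simp add: sum_list_update)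
  moreover have "(\<lambda>u. u j * m u) = (\<lambda>u. \<Prod>i\<le>a. u i ^ (?l ! i))"
  proof
    fix u :: "nat \<Rightarrow> real"
    have "(\<Prod>i\<le>a. u i ^ (?l ! i)) = u j ^ Suc (l ! j) * (\<Prod>i\<in>{..a} - {j}. u i ^ (?l ! i))"
      using l assms(2) by (subst prod.remove[of _ j]) auto
    also have "(\<Prod>i\<in>{..a} - {j}. u i ^ (?l ! i)) = (\<Prod>i\<in>{..a} - {j}. u i ^ (l ! i))"
      by (rule prod.cong) auto
    finally show "u j * m u = (\<Prod>i\<le>a. u i ^ (?l ! i))"
      using l assms(2) by (simp add: prod.remove[of "{..a}" j])
  qed
  ultimately show ?thesis
    using l unfolding monomials_def by (intro image_eqI[where x = ?l]) auto
qed

text \<open>The linear factor is evaluation at \<open>x\<close> of the polynomial with coefficients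
  \<open>u\<close>; each of its terms raises one exponent of a monomial by one.\<close>

lemma linear_form_times_span:
  assumes "f \<in> fun_vs.span (monomials a b)"
  shows "(\<lambda>u. (\<Sum>j\<le>a. u j * x ^ j) * f u) \<in> fun_vs.span (monomials a (Suc b))"
  using assms
proof (induction rule: fun_vs.span_induct_alt)
  case base
  have "(\<lambda>u. (\<Sum>j\<le>a. u j * x ^ j) * (0::(nat \<Rightarrow> real) \<Rightarrow> real) u) = 0"
    by (simp add: fun_eq_iff)
  then show ?case using fun_vs.span_zero by metis
next
  case (step c m g)
  have m: "(\<Sum>j\<le>a. (\<lambda>u. (c * x ^ j) * (u j * m u))) \<in> fun_vs.span (monomials a (Suc b))"
    using coordinate_times_monomial[OF step.hyps(1)]
    by (intro fun_vs.span_sum fun_vs.span_scale fun_vs.span_base) auto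
  have "(\<Sum>j\<le>a. (\<lambda>u. (c * x ^ j) * (u j * m u)))
      + (\<lambda>u. (\<Sum>j\<le>a. u j * x ^ j) * g u)
      = (\<lambda>u. (\<Sum>j\<le>a. u j * x ^ j) * ((\<lambda>x. c * m x) + g) u)"
  proof
    fix u
    have "(\<Sum>j\<in>J. (\<lambda>u. (c * x ^ j) * (u j * m u))) u = (\<Sum>j\<in>J. u j * x ^ j) * (c * m u)"
      if "finite J" for J
      using that by (induction J) (auto simp: algebra_simps)
    from this[of "{..a}"]
    show "((\<Sum>j\<le>a. (\<lambda>u. (c * x ^ j) * (u j * m u))) + (\<lambda>u. (\<Sum>j\<le>a. u j * x ^ j) * g u)) u
      = (\<Sum>j\<le>a. u j * x ^ j) * ((\<lambda>x. c * m x) + g) u"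
      by (simp add: algebra_simps)
  qed
  then show ?case
    using fun_vs.span_add[OF m step.IH] by simp
qed

text \<open>The points form a list, not a set, so that a point may be repeated as padding in
  \<open>skew_set_pair\<close>.\<close>

lemma product_of_linear_forms_in_span:
  "(\<lambda>u. prod_list (map (\<lambda>x. \<Sum>j\<le>a. u j * x ^ j) xs)) \<in> fun_vs.span (monomials a (length xs))"
proof (induction xs)
  case Nil
  have "(\<lambda>u. 1) \<in> monomials a 0"
    unfolding monomials_def
    by (intro image_eqI[where x = "replicate (Suc a) 0"])
      (auto simp: fun_eq_iff sum_list_replicate simp del: replicate_Suc)
  then show ?case by (simp add: fun_vs.span_base)
next
  case (Cons x xs)
  from linear_form_times_span[OF this, of x] show ?case by simp
qed

text \<open>With \<open>P i\<close> the polynomial with root set \<open>A i\<close>, the form of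
  \<open>B j\<close> vanishes at \<open>P i\<close> exactly when \<open>A i\<close> meets
  \<open>B j\<close>. The hypotheses thus give a triangular matrix with nonzero diagonal, and the
  number of monomials bounds its size.\<close>

theorem skew_set_pair:
  fixes I :: "'i::linorder set" and A B :: "'i \<Rightarrow> 'x set"
  assumes "finite I"
    and fin: "\<And>i. i \<in> I \<Longrightarrow> finite (A i) \<and> finite (B i)"
    and cardA: "\<And>i. i \<in> I \<Longrightarrow> card (A i) \<le> a"
    and cardB: "\<And>i. i \<in> I \<Longrightarrow> card (B i) \<le> b"
    and disj: "\<And>i. i \<in> I \<Longrightarrow> A i \<inter> B i = {}"
    and meet: "\<And>i j. i \<in> I \<Longrightarrow> j \<in> I \<Longrightarrow> i < j \<Longrightarrow> A i \<inter> B j \<noteq> {}"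
  shows "card I \<le> (a + b) choose a"
proof -
  define X where "X = (\<Union>i\<in>I. A i \<union> B i)"
  have "finite X" using assms(1) fin by (auto simp: X_def)
  then obtain e :: "'x \<Rightarrow> nat" where e: "inj_on e X"
    using finite_imp_inj_to_nat_seg by blast
  \<comment> \<open>\<open>Suc\<close> keeps the point \<open>0\<close> free for padding.\<close>
  define t where "t x = real (Suc (e x))" for x
  have t_inj: "t x = t y \<Longrightarrow> x = y" if "x \<in> X" "y \<in> X" for x y
    using e that by (auto simp: t_def inj_on_def)
  have t_pos: "t x \<noteq> 0" for x by (simp add: t_def)
  define P where "P i = (\<Prod>y\<in>A i. [:- t y, 1:])" for i
  \<comment> \<open>\<open>G j\<close> acts on polynomials; \<open>F j\<close> is the same
    functional written in coefficients. Since \<open>0 ^ 0 = 1\<close>, its last factor is a power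
    of \<open>u 0\<close>.\<close>
  define G where "G j p = (\<Prod>x\<in>B j. poly p (t x)) * poly p 0 ^ (b - card (B j))" for j p
  define F where "F j u = (\<Prod>x\<in>B j. \<Sum>n\<le>a. u n * t x ^ n) * (\<Sum>n\<le>a. u n * 0 ^ n) ^ (b - card (B j))"
    for j and u :: "nat \<Rightarrow> real"
  have deg: "degree (P i) \<le> a" if "i \<in> I" for i
    using cardA[OF that] unfolding P_def by (subst degree_prod_eq_sum_degree) auto
  have evalP: "(\<Sum>n\<le>a. coeff (P i) n * x ^ n) = poly (P i) x" if "i \<in> I" for i x
    unfolding poly_altdef using deg[OF that]
    by (intro sum.mono_neutral_right) (auto simp: coeff_eq_0)
  have F_coeff: "F j (coeff (P i)) = G j (P i)" if "i \<in> I" for i j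
    unfolding F_def G_def evalP[OF that] ..
  have root: "poly (P i) x = 0 \<longleftrightarrow> (\<exists>y\<in>A i. x = t y)" if "i \<in> I" for i x
    using fin[OF that] by (auto simp: P_def poly_prod)
  show ?thesis
  proof (rule order_trans[OF triangular_card_le[where F = F and p = "\<lambda>i. coeff (P i)"
            and T = "monomials a b"] card_monomials_le])
    fix j assume j: "j \<in> I"
    obtain bs where bs: "set bs = B j" "distinct bs"
      using fin[OF j] finite_distinct_list by blast
    \<comment> \<open>\<open>0\<close> is not a root of any \<open>P i\<close>, so it serves to pad \<open>B j\<close> to \<open>b\<close> points.\<close>
    let ?xs = "map t bs @ replicate (b - card (B j)) 0"
    have "length ?xs = b"
      using bs cardB[OF j] by (simp add: distinct_card[symmetric])
    moreover have "F j = (\<lambda>u. prod_list (map (\<lambda>x. \<Sum>n\<le>a. u n * x ^ n) ?xs))"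
      unfolding F_def bs(1)[symmetric]
      by (simp add: fun_eq_iff prod.distinct_set_conv_list[OF bs(2)] comp_def)
    ultimately show "F j \<in> fun_vs.span (monomials a b)"
      using product_of_linear_forms_in_span[of a ?xs] by metis
  next
    fix i assume i: "i \<in> I"
    have "poly (P i) (t x) \<noteq> 0" if "x \<in> B i" for x
      using disj[OF i] t_inj that i by (auto simp: root X_def)
    moreover have "poly (P i) 0 \<noteq> 0" using root[OF i, of 0] t_pos by metis
    ultimately show "F i (coeff (P i)) \<noteq> 0"
      using fin[OF i] by (simp add: F_coeff[OF i] G_def)
  next
    fix i j assume ij: "i \<in> I" "j \<in> I" "i < j"
    then obtain x where "x \<in> A i" "x \<in> B j" using meet by blast
    then show "F j (coeff (P i)) = 0"
      using fin[OF ij(2)] root[OF ij(1)] by (auto simp: F_coeff[OF ij(1)] G_def)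
  qed (use assms(1) finite_monomials in auto)
qed

section \<open>Diagrams with a shifted origin\<close>

text \<open>Cutting a diagram at a step leaves pieces whose origin has moved, so the recursion needs
  an arbitrary origin \<open>(p, q)\<close>.\<close>

definition shifted_diagram :: "nat \<Rightarrow> nat \<Rightarrow> (nat \<times> nat) set \<Rightarrow> bool" where
  "shifted_diagram p q Y \<longleftrightarrow> Y \<subseteq> {p<..} \<times> {q<..} \<and>
     (\<forall>i j i' j'. (i, j) \<in> Y \<longrightarrow> p < i' \<longrightarrow> i' \<le> i \<longrightarrow> q < j' \<longrightarrow> j' \<le> j \<longrightarrow> (i', j') \<in> Y)"

lemma young_diagram_shifted:
  assumes "young_diagram r c Y"
  shows "shifted_diagram 0 0 Y"
proof -
  have up: "(i', j) \<in> Y" if "i' \<le> i" "(i, j) \<in> Y" "0 < i'" for i i' j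
    using that
  proof (induction rule: inc_induct)
    case (step n)
    then have "(Suc n, j) \<in> Y" by simp
    moreover have "2 \<le> Suc n" using step.prems by simp
    ultimately show ?case using assms unfolding young_diagram_def by (metis diff_Suc_1)
  qed
  have left: "(i, j') \<in> Y" if "j' \<le> j" "(i, j) \<in> Y" "0 < j'" for i j j'
    using that
  proof (induction rule: inc_induct)
    case (step n)
    then have "(i, Suc n) \<in> Y" by simp
    moreover have "2 \<le> Suc n" using step.prems by simp
    ultimately show ?case using assms unfolding young_diagram_def by (metis diff_Suc_1)
  qed
  have "Y \<subseteq> {0<..} \<times> {0<..}" using assms by (auto simp: young_diagram_def)
  then show ?thesis
    unfolding shifted_diagram_def using up left by blast
qed

lemma shifted_diagramD:
  assumes "shifted_diagram p q Y" "(i, j) \<in> Y" "p < i'" "i' \<le> i" "q < j'" "j' \<le> j"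
  shows "(i', j') \<in> Y"
  using assms unfolding shifted_diagram_def by blast

section \<open>The staircase order of the steps\<close>

lemma steps_antitone:
  assumes Y: "shifted_diagram p q Y" and st: "(s, t) \<in> steps Y" "(s', t') \<in> steps Y"
  shows "s < s' \<longleftrightarrow> t' < t"
proof -
  have *: "t' < t" if "(s, t) \<in> steps Y" "(s', t') \<in> steps Y" "s < s'" for s t s' t'
  proof (rule ccontr)
    assume "\<not> t' < t"
    moreover have "(s', t') \<in> Y" "p < s" "q < t"
      using that Y by (auto simp: steps_def shifted_diagram_def)
    ultimately have "(s + 1, t) \<in> Y"
      using that by - (rule shifted_diagramD[OF Y, of s' t'], auto)
    then show False using that by (simp add: steps_def)
  qed
  have **: "s < s'" if "(s, t) \<in> steps Y" "(s', t') \<in> steps Y" "t' < t" for s t s' t'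
  proof (rule ccontr)
    assume "\<not> s < s'"
    moreover have "(s, t) \<in> Y" "p < s'" "q < t'"
      using that Y by (auto simp: steps_def shifted_diagram_def)
    ultimately have "(s', t' + 1) \<in> Y"
      using that by - (rule shifted_diagramD[OF Y, of s t], auto)
    then show False using that by (simp add: steps_def)
  qed
  show ?thesis using * ** st by blast
qed

text \<open>Allows steps to be counted and ordered by their rows.\<close>

lemma inj_on_fst_steps:
  assumes "shifted_diagram p q Y"
  shows "inj_on fst (steps Y)"
proof (rule inj_onI)
  fix z w assume zw: "z \<in> steps Y" "w \<in> steps Y" "fst z = fst w"
  obtain s t t' where "z = (s, t)" "w = (s, t')" using zw(3) by (metis prod.collapse)
  then show "z = w"
    using steps_antitone[OF assms, of s t s t'] steps_antitone[OF assms, of s t' s t] zw by simp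
qed

lemma finite_steps: "finite Y \<Longrightarrow> finite (steps Y)"
  by (rule finite_subset[of _ Y]) (auto simp: steps_def)

text \<open>A cell with maximal coordinate sum is a step.\<close>

lemma steps_nonempty:
  assumes "finite Y" "Y \<noteq> {}"
  shows "steps Y \<noteq> {}"
proof -
  have "Max ((\<lambda>w. fst w + snd w) ` Y) \<in> (\<lambda>w. fst w + snd w) ` Y"
    using assms by (intro Max_in) auto
  then obtain z where "z \<in> Y" "Max ((\<lambda>w. fst w + snd w) ` Y) = fst z + snd z"
    by blast
  then have z: "fst w + snd w \<le> fst z + snd z" if "w \<in> Y" for w
    using Max_ge[of "(\<lambda>w. fst w + snd w) ` Y" "fst w + snd w"] assms(1) that by auto
  have "z \<in> steps Y"
    using \<open>z \<in> Y\<close> z[of "(fst z + 1, snd z)"] z[of "(fst z, snd z + 1)"]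
    by (auto simp: steps_def)
  then show ?thesis by auto
qed

section \<open>Constructing covers\<close>

text \<open>Take the least \<open>s\<close> with fewer than \<open>P\<close> elements above it. Its
  predecessor, if any, has at least \<open>P\<close> above it, \<open>s\<close> included, which
  leaves fewer than \<open>Q\<close> below \<open>s\<close>.\<close>

lemma split_finite_linorder:
  fixes S :: "'a::linorder set"
  assumes "finite S" "S \<noteq> {}" "card S < P + Q" "0 < P" "0 < Q"
  obtains s where "s \<in> S" "card {x \<in> S. s < x} < P" "card {x \<in> S. x < s} < Q"
proof -
  define G where "G = {s \<in> S. card {x \<in> S. s < x} < P}"
  have "{x \<in> S. Max S < x} = {}" using assms(1) Max_ge leD by blast
  then have "card {x \<in> S. Max S < x} < P" using assms(4) by (metis card.empty)
  then have "Max S \<in> G"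
    unfolding G_def using assms(1,2) by simp
  moreover have "finite G" using assms(1) by (auto simp: G_def)
  ultimately obtain s where "s \<in> G" and least: "\<And>x. x \<in> G \<Longrightarrow> s \<le> x"
    using Min_in Min_le by (metis empty_iff)
  then have s: "s \<in> S" "card {x \<in> S. s < x} < P"
    by (auto simp: G_def)
  let ?V = "{x \<in> S. x < s}" and ?U = "{x \<in> S. s < x}"
  have "card ?V < Q"
  proof (cases "?V = {}")
    case True
    then show ?thesis using assms(5) by (metis card.empty)
  next
    case False
    have finV: "finite ?V" using assms(1) by simp
    let ?m = "Max ?V"
    have m: "?m \<in> S" "?m < s" using Max_in[OF finV False] by auto
    have "?m \<notin> G" using least m(2) leD by blast
    then have "P \<le> card {x \<in> S. ?m < x}" using m(1) by (auto simp: G_def)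
    also have "{x \<in> S. ?m < x} = insert s ?U"
    proof -
      have "x = s \<or> s < x" if "x \<in> S" "?m < x" for x
      proof (rule ccontr)
        assume "\<not> (x = s \<or> s < x)"
        then have "x \<le> ?m" using that(1) by (intro Max_ge[OF finV]) auto
        then show False using that(2) by simp
      qed
      then show ?thesis using m s by auto
    qed
    also have "card \<dots> = Suc (card ?U)" using assms(1) by simp
    finally have "P \<le> Suc (card ?U)" .
    moreover have "card S = card (?V \<union> insert s ?U)"
      using s by (intro arg_cong[of _ _ card]) auto
    moreover have "card (?V \<union> insert s ?U) = card ?V + card (insert s ?U)"
      using assms(1) by (intro card_Un_disjoint) auto
    moreover have "card (insert s ?U) = Suc (card ?U)" using assms(1) by simp
    ultimately show ?thesis using assms(3) by linarith
  qed
  then show ?thesis using that s by blast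
qed

text \<open>Row and column budgets are separate because each recursive call lowers only one of them.
  Nonempty products ensure that a rectangle uses only rows and columns of the piece it helps to
  cover.\<close>

lemma cover_exists:
  assumes "finite Y" "shifted_diagram p q Y" "card (steps Y) < (a + b) choose a"
  shows "\<exists>C. finite C \<and> (\<forall>R\<in>C. cells R \<noteq> {}) \<and> covers C Y \<and>
           (\<forall>i. card {R \<in> C. uses_row R i} \<le> a) \<and> (\<forall>j. card {R \<in> C. uses_column R j} \<le> b)"
  using assms
proof (induction "a + b" arbitrary: a b p q Y rule: less_induct)
  case less
  note Y = less.prems(2)
  show ?case
  proof (cases "Y = {}")
    case True
    then show ?thesis by (intro exI[of _ "{}"]) (auto simp: covers_def)
  next
    case False
    note finZ = finite_steps[OF less.prems(1)]
    have Z: "steps Y \<noteq> {}" using steps_nonempty[OF less.prems(1) False] .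
    then have "card (steps Y) \<noteq> 0" using finZ by simp
    \<comment> \<open>A zero budget makes the binomial coefficient \<open>1\<close>, leaving no room
      for a step.\<close>
    then have "a \<noteq> 0" "b \<noteq> 0" using less.prems(3) by (auto intro!: gr0I)
    then obtain a' b' where ab: "a = Suc a'" "b = Suc b'" by (meson not0_implies_Suc)
    \<comment> \<open>Pascal's rule; the two summands are the bounds for the parts below and to the
      right of the chosen step.\<close>
    have "card (fst ` steps Y) < ((a + b') choose a) + ((a' + b) choose a')"
      using less.prems(3) card_image[OF inj_on_fst_steps[OF Y]] by (simp add: ab)
    then obtain s where s: "s \<in> fst ` steps Y"
      "card {x \<in> fst ` steps Y. s < x} < (a + b') choose a"
      "card {x \<in> fst ` steps Y. x < s} < (a' + b) choose a'"
      using split_finite_linorder[of "fst ` steps Y" "(a + b') choose a" "(a' + b) choose a'"]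
        finZ Z by (auto simp: zero_less_binomial)
    then obtain t where st: "(s, t) \<in> steps Y" by auto
    then have stY: "(s, t) \<in> Y" "(Suc s, t) \<notin> Y" "(s, Suc t) \<notin> Y" "p < s" "q < t"
      using Y by (auto simp: steps_def shifted_diagram_def)
    define D where "D = {(i, j) \<in> Y. s < i}"
    define E where "E = {(i, j) \<in> Y. t < j}"
    have D_col: "j \<le> t" if "(i, j) \<in> D" for i j
      using shifted_diagramD[OF Y, of i j "Suc s" t] that stY by (force simp: D_def)
    have E_row: "i \<le> s" if "(i, j) \<in> E" for i j
      using shifted_diagramD[OF Y, of i j s "Suc t"] that stY by (force simp: E_def)
    \<comment> \<open>The neighbours that decide whether a cell is a step lie below it or to its
      right, so they are on the same side of the cut.\<close>
    have stepsD: "steps D = {z \<in> steps Y. s < fst z}"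
      by (auto simp: steps_def D_def)
    have stepsE: "steps E = {z \<in> steps Y. t < snd z}"
      by (auto simp: steps_def E_def)
    have stepsE': "steps E = {z \<in> steps Y. fst z < s}"
      unfolding stepsE using steps_antitone[OF Y _ st] by auto
    have inj: "inj_on fst {z \<in> steps Y. Q z}" for Q
      using inj_on_fst_steps[OF Y] by (rule inj_on_subset) auto
    have "card (steps D) = card (fst ` steps D)"
      using inj unfolding stepsD by (simp add: card_image)
    also have "fst ` steps D = {x \<in> fst ` steps Y. s < x}" by (auto simp: stepsD)
    finally have cardD: "card (steps D) < (a + b') choose a" using s by simp
    have "card (steps E) = card (fst ` steps E)"
      using inj unfolding stepsE' by (simp add: card_image)
    also have "fst ` steps E = {x \<in> fst ` steps Y. x < s}" by (auto simp: stepsE')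
    finally have cardE: "card (steps E) < (a' + b) choose a'" using s by simp
    have "finite D" "finite E"
      using less.prems(1) by (auto simp: D_def E_def intro: finite_subset[of _ Y])
    have "shifted_diagram s q D" "shifted_diagram p t E"
      using Y stY(4,5) unfolding shifted_diagram_def D_def E_def by auto
    obtain C1 where C1: "finite C1" "\<And>R. R \<in> C1 \<Longrightarrow> cells R \<noteq> {}" "covers C1 D"
      "\<And>i. card {R \<in> C1. uses_row R i} \<le> a" "\<And>j. card {R \<in> C1. uses_column R j} \<le> b'"
      using less.hyps[OF _ \<open>finite D\<close> \<open>shifted_diagram s q D\<close> cardD] ab by auto
    obtain C2 where C2: "finite C2" "\<And>R. R \<in> C2 \<Longrightarrow> cells R \<noteq> {}" "covers C2 E"
      "\<And>i. card {R \<in> C2. uses_row R i} \<le> a'" "\<And>j. card {R \<in> C2. uses_column R j} \<le> b"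
      using less.hyps[OF _ \<open>finite E\<close> \<open>shifted_diagram p t E\<close> cardE] ab by auto
    have C1_row: "s < i" if R: "R \<in> C1" "uses_row R i" for R i
    proof -
      obtain j where "(i, j) \<in> cells R"
        using C1(2)[OF R(1)] R(2) by (auto simp: cells_def uses_row_def)
      then have "(i, j) \<in> D" using C1(3) R(1) by (auto simp: covers_def)
      then show ?thesis by (simp add: D_def)
    qed
    have C1_col: "j \<le> t" if R: "R \<in> C1" "uses_column R j" for R j
    proof -
      obtain i where "(i, j) \<in> cells R"
        using C1(2)[OF R(1)] R(2) by (auto simp: cells_def uses_column_def)
      then have "(i, j) \<in> D" using C1(3) R(1) by (auto simp: covers_def)
      then show ?thesis by (rule D_col)
    qed
    have C2_row: "i \<le> s" if R: "R \<in> C2" "uses_row R i" for R i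
    proof -
      obtain j where "(i, j) \<in> cells R"
        using C2(2)[OF R(1)] R(2) by (auto simp: cells_def uses_row_def)
      then have "(i, j) \<in> E" using C2(3) R(1) by (auto simp: covers_def)
      then show ?thesis by (rule E_row)
    qed
    have C2_col: "t < j" if R: "R \<in> C2" "uses_column R j" for R j
    proof -
      obtain i where "(i, j) \<in> cells R"
        using C2(2)[OF R(1)] R(2) by (auto simp: cells_def uses_column_def)
      then have "(i, j) \<in> E" using C2(3) R(1) by (auto simp: covers_def)
      then show ?thesis by (simp add: E_def)
    qed
    \<comment> \<open>The full rectangle from the origin to the corner \<open>(s, t)\<close>. It
      shares its columns with \<open>D\<close> and its rows with \<open>E\<close>, costing one unit
      of the matching budget.\<close>
    define R0 :: gen_rect where "R0 = ({p<..s}, {q<..t})"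
    let ?C = "insert R0 (C1 \<union> C2)"
    have cellsR0: "cells R0 = {(i, j) \<in> Y. i \<le> s \<and> j \<le> t}"
      using shifted_diagramD[OF Y stY(1)] Y
      by (auto simp: R0_def cells_def shifted_diagram_def)
    have "covers ?C Y"
    proof -
      have "(\<Union>R\<in>?C. cells R) = cells R0 \<union> D \<union> E"
        using C1(3) C2(3) by (auto simp: covers_def)
      also have "\<dots> = Y" by (auto simp: cellsR0 D_def E_def)
      finally show ?thesis by (simp add: covers_def)
    qed
    moreover have "cells R0 \<noteq> {}" using stY(1) cellsR0 by auto
    then have "\<forall>R\<in>?C. cells R \<noteq> {}" using C1(2) C2(2) by auto
    moreover have "card {R \<in> ?C. uses_row R i} \<le> a" for i
    proof (cases "s < i")
      case True
      then have "{R \<in> ?C. uses_row R i} = {R \<in> C1. uses_row R i}"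
        using C2_row[of _ i] by (auto simp: R0_def uses_row_def)
      then show ?thesis using C1(4) by simp
    next
      case False
      then have "{R \<in> ?C. uses_row R i} \<subseteq> insert R0 {R \<in> C2. uses_row R i}"
        using C1_row by auto
      then have "card {R \<in> ?C. uses_row R i} \<le> card (insert R0 {R \<in> C2. uses_row R i})"
        using C2(1) by (intro card_mono) auto
      also have "\<dots> \<le> Suc (card {R \<in> C2. uses_row R i})"
        by (rule card_insert_le_m1) auto
      also have "\<dots> \<le> a" using C2(4)[of i] ab by simp
      finally show ?thesis .
    qed
    moreover have "card {R \<in> ?C. uses_column R j} \<le> b" for j
    proof (cases "t < j")
      case True
      then have "{R \<in> ?C. uses_column R j} = {R \<in> C2. uses_column R j}"
        using C1_col[of _ j] by (auto simp: R0_def uses_column_def)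
      then show ?thesis using C2(5) by simp
    next
      case False
      then have "{R \<in> ?C. uses_column R j} \<subseteq> insert R0 {R \<in> C1. uses_column R j}"
        using C2_col by auto
      then have "card {R \<in> ?C. uses_column R j} \<le> card (insert R0 {R \<in> C1. uses_column R j})"
        using C1(1) by (intro card_mono) auto
      also have "\<dots> \<le> Suc (card {R \<in> C1. uses_column R j})"
        by (rule card_insert_le_m1) auto
      also have "\<dots> \<le> b" using C1(5)[of j] ab by simp
      finally show ?thesis .
    qed
    ultimately show ?thesis
      using C1(1) C2(1) by (intro exI[of _ ?C]) auto
  qed
qed

section \<open>The bound on the number of steps\<close>

text \<open>Row \<open>i\<close> and column \<open>j\<close> share a rectangle iff
  \<open>(i, j)\<close> is a cell. For a step \<open>(s, t)\<close> the cell
  \<open>(s + 1, t)\<close> is missing, but it is present when \<open>s\<close> is replaced by the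
  row of an earlier step. One extra index makes the inequality strict.\<close>

lemma cover_card_steps:
  assumes Y: "young_diagram r c Y"
    and rect: "\<And>R. R \<in> C \<Longrightarrow> gen_rectangle_in r c Y R" and cov: "covers C Y"
    and rows: "\<And>i. i \<in> {1..r} \<Longrightarrow> card {R \<in> C. uses_row R i} \<le> a"
    and cols: "\<And>j. j \<in> {1..c} \<Longrightarrow> card {R \<in> C. uses_column R j} \<le> b"
  shows "card (steps Y) < (a + b) choose a"
proof -
  have Ysub: "Y \<subseteq> {1..r} \<times> {1..c}" using Y by (simp add: young_diagram_def)
  then have "finite Y" by (rule finite_subset) simp
  note finZ = finite_steps[OF this]
  note Y' = young_diagram_shifted[OF Y]
  have "C \<subseteq> Pow {1..r} \<times> Pow {1..c}"
    using rect unfolding gen_rectangle_in_def mem_Times_iff Pow_iff subset_iff by blast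
  then have finC: "finite C" by (rule finite_subset) simp
  have sub: "fst R \<subseteq> {1..r}" "snd R \<subseteq> {1..c}" if "R \<in> C" for R
    using rect[OF that] by (auto simp: gen_rectangle_in_def)
  \<comment> \<open>The bounds must extend beyond the grid: row \<open>s + 1\<close> may be
    \<open>r + 1\<close>, and the extra pair has column \<open>0\<close>.\<close>
  have rows': "card {R \<in> C. uses_row R i} \<le> a" for i
  proof (cases "i \<in> {1..r}")
    case False
    then have "{R \<in> C. uses_row R i} = {}"
      using sub(1) unfolding uses_row_def by blast
    then show ?thesis by (metis card.empty le0)
  qed (rule rows)
  have cols': "card {R \<in> C. uses_column R j} \<le> b" for j
  proof (cases "j \<in> {1..c}")
    case False
    then have "{R \<in> C. uses_column R j} = {}"
      using sub(2) unfolding uses_column_def by blast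
    then show ?thesis by (metis card.empty le0)
  qed (rule cols)
  have meet: "{R \<in> C. uses_row R i} \<inter> {R \<in> C. uses_column R j} \<noteq> {} \<longleftrightarrow> (i, j) \<in> Y" for i j
    using cov by (fastforce simp: covers_def cells_def uses_row_def uses_column_def)
  let ?S = "fst ` steps Y"
  have "\<forall>s\<in>?S. \<exists>t. (s, t) \<in> steps Y" by auto
  then obtain g where g: "\<And>s. s \<in> ?S \<Longrightarrow> (s, g s) \<in> steps Y" by metis
  have zero: "0 \<notin> ?S" using Ysub by (auto simp: steps_def)
  \<comment> \<open>The index \<open>0\<close> stands for an additional pair, with row \<open>1\<close> and the unused column \<open>0\<close>.\<close>
  define t where "t s = (if s = 0 then 0 else g s)" for s
  have t: "(s, t s) \<in> steps Y" if "s \<in> ?S" for s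
    using g[OF that] that zero by (auto simp: t_def)
  have "card (insert 0 ?S) \<le> (a + b) choose a"
  proof (rule skew_set_pair[where A = "\<lambda>s. {R \<in> C. uses_row R (s + 1)}"
        and B = "\<lambda>s. {R \<in> C. uses_column R (t s)}"])
    fix s assume "s \<in> insert 0 ?S"
    then have "(s + 1, t s) \<notin> Y"
    proof
      assume "s = 0"
      then show ?thesis using Ysub by (auto simp: t_def)
    next
      assume "s \<in> ?S"
      then show ?thesis using t[of s] unfolding steps_def by blast
    qed
    then show "{R \<in> C. uses_row R (s + 1)} \<inter> {R \<in> C. uses_column R (t s)} = {}"
      using meet by blast
  next
    fix s s' assume *: "s \<in> insert 0 ?S" "s' \<in> insert 0 ?S" "s < s'"
    then have "(s', t s') \<in> Y" "0 < t s'"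
      using t[of s'] Ysub by (auto simp: steps_def)
    \<comment> \<open>Since \<open>s + 1 \<le> s'\<close>, this cell lies weakly above the step of
      row \<open>s'\<close>; this includes \<open>s = 0\<close>.\<close>
    then have "(s + 1, t s') \<in> Y"
      using * by - (rule shifted_diagramD[OF Y', of s' "t s'"], auto)
    then show "{R \<in> C. uses_row R (s + 1)} \<inter> {R \<in> C. uses_column R (t s')} \<noteq> {}"
      using meet by blast
  qed (use finZ finC rows' cols' in auto)
  then show ?thesis
    using zero finZ card_image[OF inj_on_fst_steps[OF Y']] by simp
qed

theorem theorem1:
  fixes k r c :: nat and Y :: "(nat \<times> nat) set"
  assumes "k \<ge> 1"
    and "young_diagram r c Y"
  shows "(\<exists>C. (\<forall>R\<in>C. gen_rectangle_in r c Y R) \<and> covers C Y \<and>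
              (\<forall>i\<in>{1..r}. card {R \<in> C. uses_row R i} \<le> k) \<and>
              (\<forall>j\<in>{1..c}. card {R \<in> C. uses_column R j} \<le> k))
         \<longleftrightarrow> card (steps Y) < (2 * k) choose k" (is "?L \<longleftrightarrow> ?R")
proof
  assume ?L
  then obtain C where "\<forall>R\<in>C. gen_rectangle_in r c Y R" "covers C Y"
    "\<forall>i\<in>{1..r}. card {R \<in> C. uses_row R i} \<le> k" "\<forall>j\<in>{1..c}. card {R \<in> C. uses_column R j} \<le> k"
    by blast
  then show ?R
    using cover_card_steps[OF assms(2), of C k k] by (simp add: mult_2)
next
  assume ?R
  have Ysub: "Y \<subseteq> {1..r} \<times> {1..c}" using assms(2) by (simp add: young_diagram_def)
  then have "finite Y" by (rule finite_subset) simp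
  with \<open>?R\<close> obtain C where C: "\<And>R. R \<in> C \<Longrightarrow> cells R \<noteq> {}" "covers C Y"
    "\<And>i. card {R \<in> C. uses_row R i} \<le> k" "\<And>j. card {R \<in> C. uses_column R j} \<le> k"
    using cover_exists[OF _ young_diagram_shifted[OF assms(2)], of k k] by (auto simp: mult_2)
  \<comment> \<open>Nonemptiness is what places both factors inside the grid: with an empty factor,
    the other one could be arbitrary.\<close>
  have "gen_rectangle_in r c Y R" if "R \<in> C" for R
  proof -
    have sub: "cells R \<subseteq> Y" using C(2) that by (auto simp: covers_def)
    then have "fst R \<times> snd R \<subseteq> {1..r} \<times> {1..c}" using Ysub by (auto simp: cells_def)
    moreover have "fst R \<noteq> {}" "snd R \<noteq> {}" using C(1)[OF that] by (auto simp: cells_def)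
    ultimately show ?thesis
      using sub unfolding gen_rectangle_in_def times_subset_iff by blast
  qed
  then show ?L using C by blast
qed

end
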